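(* Let $\mathcal{V}$ be a variety of a plural type (possibly containing constant symbols), and let $\mathbf{A}$ be the P\l onka sum over a semilattice direct system $\mathbb{A}=(\{\mathbf{A}_i\}_{i\in I},(I,\le),\{p_{ij}\}_{i\le j})$ of algebras in $\mathcal{V}$. Then $\mathbf{A}$ is subdirectly irreducible if and only if one of the following holds: (1) $\mathbf{A}$ is a subdirectly irreducible member of $\mathcal{V}$; (2) there exists a subdirectly irreducible algebra $\mathbf{B}\in\mathcal{V}$ without absorbing elements such that $\mathbf{A}\cong\mathbf{B}^{\ast}$.
   Context: A type is plural if it contains at least one operation symbol of arity at least $2$. A semilattice direct system $\mathbb{A}=(\{\mathbf{A}_i\}_{i\in I},(I,\le),\{p_{ij}\}_{i\le j})$ consists of a join-semilattice $(I,\le)$ with join $\vee$ (required to have a least element $i_0$ when the type contains constants), a family of algebras $\mathbf{A}_i$ of the same type with pairwise disjoint universes, and homomorphisms $p_{ij}\colon\mathbf{A}_i\to\mathbf{A}_j$ for $i\le j$ with $p_{ii}=\mathrm{id}$ and $p_{ik}=p_{jk}\circ p_{ij}$ for $i\le j\le k$. Its P\l onka sum is the algebra with universe $\bigcup_{i\in I}A_i$ in which, for every $n$-ary operation $g$ with $n\ge1$ and $a_1\in A_{i_1},\dots,a_n\in A_{i_n}$, $g(a_1,\dots,a_n)=g^{\mathbf{A}_j}(p_{i_1j}(a_1),\dots,p_{i_nj}(a_n))$ with $j=i_1\vee\dots\vee i_n$, and every constant $c$ is interpreted as $c^{\mathbf{A}_{i_0}}$. For an algebra $\mathbf{B}$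 and $\infty\notin B$, $\mathbf{B}^{\ast}$ denotes the P\l onka sum over the system indexed by the two-element chain $i<j$, with $\mathbf{A}_i=\mathbf{B}$, $\mathbf{A}_j$ the trivial algebra with universe $\{\infty\}$, and $p_{ij}$ the unique map. An element $a$ of a non-trivial algebra $\mathbf{B}$ is absorbing if for every operation symbol $f$ of arity $n\ge1$, $a\in\{x_1,\dots,x_n\}$ implies $f^{\mathbf{B}}(x_1,\dots,x_n)=a$; by this definition trivial algebras have no absorbing elements. Convention: trivial algebras count as subdirectly irreducible. *)

theory Defs
  imports Main "HOL-Library.FuncSet" "HOL-Library.Disjoint_Sets"
begin

text \<open>A type of algebras is an arity function on a HOL type of operation symbols; constants are the
  symbols of arity \<open>0\<close>. Operations take argument lists; only the values on lists of the
  right length over the universe are meaningful.\<close>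

definition plural :: "('f \<Rightarrow> nat) \<Rightarrow> bool" where
  "plural ar \<longleftrightarrow> (\<exists>f. ar f \<ge> 2)"

record ('f, 'a) algebra =
  univ :: "'a set"
  oper :: "'f \<Rightarrow> 'a list \<Rightarrow> 'a"

definition args :: "('f \<Rightarrow> nat) \<Rightarrow> ('f, 'a) algebra \<Rightarrow> 'f \<Rightarrow> 'a list set" where
  "args ar A f = {xs. length xs = ar f \<and> set xs \<subseteq> univ A}"

definition is_algebra :: "('f \<Rightarrow> nat) \<Rightarrow> ('f, 'a) algebra \<Rightarrow> bool" where
  "is_algebra ar A \<longleftrightarrow> univ A \<noteq> {} \<and> (\<forall>f. \<forall>xs \<in> args ar A f. oper A f xs \<in> univ A)"

definition trivial :: "('f, 'a) algebra \<Rightarrow> bool" where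
  "trivial A \<longleftrightarrow> (\<exists>x. univ A = {x})"

definition hom :: "('f \<Rightarrow> nat) \<Rightarrow> ('f, 'a) algebra \<Rightarrow> ('f, 'b) algebra \<Rightarrow> ('a \<Rightarrow> 'b) \<Rightarrow> bool" where
  "hom ar A B h \<longleftrightarrow> h ` univ A \<subseteq> univ B \<and>
     (\<forall>f. \<forall>xs \<in> args ar A f. h (oper A f xs) = oper B f (map h xs))"

definition iso :: "('f \<Rightarrow> nat) \<Rightarrow> ('f, 'a) algebra \<Rightarrow> ('f, 'b) algebra \<Rightarrow> ('a \<Rightarrow> 'b) \<Rightarrow> bool" where
  "iso ar A B h \<longleftrightarrow> hom ar A B h \<and> bij_betw h (univ A) (univ B)"

definition isomorphic :: "('f \<Rightarrow> nat) \<Rightarrow> ('f, 'a) algebra \<Rightarrow> ('f, 'b) algebra \<Rightarrow> bool" where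
  "isomorphic ar A B \<longleftrightarrow> (\<exists>h. iso ar A B h)"


datatype 'f trm = Var nat | App 'f "'f trm list"

fun wf_trm :: "('f \<Rightarrow> nat) \<Rightarrow> 'f trm \<Rightarrow> bool" where
  "wf_trm ar (Var n) \<longleftrightarrow> True"
| "wf_trm ar (App f ts) \<longleftrightarrow> length ts = ar f \<and> (\<forall>t \<in> set ts. wf_trm ar t)"

fun eval_trm :: "('f, 'a) algebra \<Rightarrow> (nat \<Rightarrow> 'a) \<Rightarrow> 'f trm \<Rightarrow> 'a" where
  "eval_trm A \<rho> (Var n) = \<rho> n"
| "eval_trm A \<rho> (App f ts) = oper A f (map (eval_trm A \<rho>) ts)"

definition satisfies :: "('f, 'a) algebra \<Rightarrow> 'f trm \<times> 'f trm \<Rightarrow> bool" where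
  "satisfies A e \<longleftrightarrow>
     (\<forall>\<rho>. range \<rho> \<subseteq> univ A \<longrightarrow> eval_trm A \<rho> (fst e) = eval_trm A \<rho> (snd e))"

text \<open>A variety is an equational class. A class of algebras is rendered by its members whose
  universe lies in a given HOL type; closure under arbitrary products is not expressible for such
  a set, which is why varieties are given by identities and not by closure under H, S and P.\<close>

definition variety :: "('f \<Rightarrow> nat) \<Rightarrow> ('f, 'a) algebra set \<Rightarrow> bool" where
  "variety ar V \<longleftrightarrow> (\<exists>E. (\<forall>(s, t) \<in> E. wf_trm ar s \<and> wf_trm ar t) \<and>
     V = {A. is_algebra ar A \<and> (\<forall>e \<in> E. satisfies A e)})"


definition product_algebra :: "'j set \<Rightarrow> ('j \<Rightarrow> ('f, 'a) algebra) \<Rightarrow> ('f, 'j \<Rightarrow> 'a) algebra" where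
  "product_algebra J C =
     \<lparr>univ = (\<Pi>\<^sub>E j\<in>J. univ (C j)),
      oper = (\<lambda>f xs. \<lambda>j\<in>J. oper (C j) f (map (\<lambda>x. x j) xs))\<rparr>"

definition subdirect_embedding ::
  "('f \<Rightarrow> nat) \<Rightarrow> ('f, 'a) algebra \<Rightarrow> 'j set \<Rightarrow> ('j \<Rightarrow> ('f, 'b) algebra) \<Rightarrow> ('a \<Rightarrow> 'j \<Rightarrow> 'b) \<Rightarrow> bool"
where
  "subdirect_embedding ar A J C h \<longleftrightarrow>
     (\<forall>j\<in>J. is_algebra ar (C j)) \<and>
     hom ar A (product_algebra J C) h \<and> inj_on h (univ A) \<and>
     (\<forall>j\<in>J. (\<lambda>x. h x j) ` univ A = univ (C j))"

text \<open>Index sets and factors range over fixed HOL types here. This loses nothing: given a subdirect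
  embedding with arbitrary factors, keep one factor for each kernel of a coordinate map. The kernels
  (of type \<open>('a \<times> 'a) set\<close>) can then serve as indices and the quotients of \<open>A\<close> by
  them (with universes of type \<open>'a set set\<close>) as factors. The first disjunct of the second
  conjunct is needed because a trivial algebra embeds in the empty product.\<close>

definition subdirectly_irreducible :: "('f \<Rightarrow> nat) \<Rightarrow> ('f, 'a) algebra \<Rightarrow> bool" where
  "subdirectly_irreducible ar A \<longleftrightarrow> is_algebra ar A \<and>
     (trivial A \<or>
      (\<forall>(J :: ('a \<times> 'a) set set) (C :: ('a \<times> 'a) set \<Rightarrow> ('f, 'a set) algebra) h.
         subdirect_embedding ar A J C h \<longrightarrow> (\<exists>j\<in>J. iso ar A (C j) (\<lambda>x. h x j))))"

definition absorbing :: "('f \<Rightarrow> nat) \<Rightarrow> ('f, 'a) algebra \<Rightarrow> 'a \<Rightarrow> bool" where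
  "absorbing ar B a \<longleftrightarrow> \<not> trivial B \<and> a \<in> univ B \<and>
     (\<forall>f. ar f \<ge> 1 \<longrightarrow> (\<forall>xs \<in> args ar B f. a \<in> set xs \<longrightarrow> oper B f xs = a))"


text \<open>The index semilattice is a type of class \<open>semilattice_sup\<close>, hence nonempty.\<close>

definition semilattice_direct_system ::
  "('f \<Rightarrow> nat) \<Rightarrow> ('i::semilattice_sup \<Rightarrow> ('f, 'a) algebra) \<Rightarrow> ('i \<Rightarrow> 'i \<Rightarrow> 'a \<Rightarrow> 'a) \<Rightarrow> bool"
where
  "semilattice_direct_system ar A p \<longleftrightarrow>
     ((\<exists>c. ar c = 0) \<longrightarrow> (\<exists>i0::'i. \<forall>i. i0 \<le> i)) \<and>
     (\<forall>i. is_algebra ar (A i)) \<and>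
     disjoint_family (\<lambda>i. univ (A i)) \<and>
     (\<forall>i j. i \<le> j \<longrightarrow> hom ar (A i) (A j) (p i j)) \<and>
     (\<forall>i. \<forall>a \<in> univ (A i). p i i a = a) \<and>
     (\<forall>i j k. i \<le> j \<longrightarrow> j \<le> k \<longrightarrow> (\<forall>a \<in> univ (A i). p i k a = p j k (p i j a)))"

definition fibre_index :: "('i \<Rightarrow> ('f, 'a) algebra) \<Rightarrow> 'a \<Rightarrow> 'i" where
  "fibre_index A a = (THE i. a \<in> univ (A i))"

text \<open>The empty argument list occurs exactly for constants.\<close>

definition plonka_sum ::
  "('i::semilattice_sup \<Rightarrow> ('f, 'a) algebra) \<Rightarrow> ('i \<Rightarrow> 'i \<Rightarrow> 'a \<Rightarrow> 'a) \<Rightarrow> ('f, 'a) algebra"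
where
  "plonka_sum A p =
     \<lparr>univ = (\<Union>i. univ (A i)),
      oper = (\<lambda>g xs.
        if xs = [] then oper (A (THE i0. \<forall>i. i0 \<le> i)) g []
        else let j = Sup_fin (fibre_index A ` set xs)
             in oper (A j) g (map (\<lambda>a. p (fibre_index A a) j a) xs))\<rparr>"

definition trivial_algebra :: "'a \<Rightarrow> ('f, 'a) algebra" where
  "trivial_algebra x = \<lparr>univ = {x}, oper = (\<lambda>_ _. x)\<rparr>"

text \<open>The algebra \<open>B\<^sup>*\<close>, meaningful for \<open>u \<notin> univ B\<close>; the two-element chain is
  \<open>False < True\<close>. Since \<open>u\<close> is the only element over \<open>True\<close>, the map from
  \<open>True\<close> to \<open>True\<close> below is the identity there.\<close>

definition star :: "('f, 'a) algebra \<Rightarrow> 'a \<Rightarrow> ('f, 'a) algebra" where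
  "star B u = plonka_sum (\<lambda>i::bool. if i then trivial_algebra u else B)
                         (\<lambda>i j a. if j then u else a)"

end

theory Submission
  imports Defs
begin

text \<open>Sending a fibre \<open>j \<le> i\<close> to \<open>A\<^sub>i\<close> by the transition map, and all other fibres to \<open>\<infinity>\<close>,
  is a homomorphism from the P\l{}onka sum onto \<open>A\<^sub>i\<close> (if \<open>i\<close> is the greatest index) or
  onto \<open>A\<^sub>i\<^sup>*\<close>, and these homomorphisms separate points. So a subdirectly irreducible sum is
  isomorphic to some \<open>A\<^sub>i\<close> or \<open>A\<^sub>i\<^sup>*\<close>. It remains to see when \<open>B\<^sup>*\<close> is subdirectly
  irreducible: congruences of \<open>B\<close> extend to \<open>B\<^sup>*\<close> with \<open>\<infinity>\<close> as a singleton class, and a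
  non-identity congruence of \<open>B\<^sup>*\<close> that is the identity on \<open>B\<close> identifies \<open>\<infinity>\<close> with an
  element that is absorbing unless \<open>B\<close> is trivial.\<close>

section \<open>Congruences and subdirect irreducibility\<close>

definition congruence :: "('f \<Rightarrow> nat) \<Rightarrow> ('f, 'a) algebra \<Rightarrow> ('a \<times> 'a) set \<Rightarrow> bool" where
  "congruence ar A \<theta> \<longleftrightarrow> equiv (univ A) \<theta> \<and>
     (\<forall>f. \<forall>xs \<in> args ar A f. \<forall>ys \<in> args ar A f.
        list_all2 (\<lambda>x y. (x, y) \<in> \<theta>) xs ys \<longrightarrow> (oper A f xs, oper A f ys) \<in> \<theta>)"

text \<open>The least non-identity congruence is recorded by one pair contained in all non-identity
  congruences, so no lattice of congruences has to be formed. A congruence is reflexive on the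
  universe, hence \<open>\<not> \<theta> \<subseteq> Id\<close> says exactly that it is not the
  identity.\<close>

definition has_monolith :: "('f \<Rightarrow> nat) \<Rightarrow> ('f, 'a) algebra \<Rightarrow> bool" where
  "has_monolith ar A \<longleftrightarrow> (\<exists>c \<in> univ A. \<exists>d \<in> univ A. c \<noteq> d \<and>
     (\<forall>\<theta>. congruence ar A \<theta> \<longrightarrow> \<not> \<theta> \<subseteq> Id \<longrightarrow> (c, d) \<in> \<theta>))"

text \<open>Operations act on chosen representatives; for a congruence the choice is immaterial, see
  \<open>quotient_algebra_oper\<close>. Elements have type \<open>'a set\<close>, as the factors in
  \<open>subdirectly_irreducible\<close> must.\<close>

definition quotient_algebra :: "('f, 'a) algebra \<Rightarrow> ('a \<times> 'a) set \<Rightarrow> ('f, 'a set) algebra" where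
  "quotient_algebra A \<theta> =
     \<lparr>univ = univ A // \<theta>,
      oper = (\<lambda>f Xs. \<theta> `` {oper A f (map (\<lambda>X. SOME x. x \<in> X) Xs)})\<rparr>"

lemma oper_closed: "is_algebra ar A \<Longrightarrow> xs \<in> args ar A f \<Longrightarrow> oper A f xs \<in> univ A"
  by (auto simp: is_algebra_def)

lemma args_map: "xs \<in> args ar A f \<Longrightarrow> h ` univ A \<subseteq> univ B \<Longrightarrow> map h xs \<in> args ar B f"
  by (auto simp: args_def)

lemma hom_oper: "hom ar A B h \<Longrightarrow> xs \<in> args ar A f \<Longrightarrow> h (oper A f xs) = oper B f (map h xs)"
  by (auto simp: hom_def)

lemma congruenceI:
  assumes "equiv (univ A) \<theta>"
    and "\<And>f xs ys. \<lbrakk>xs \<in> args ar A f; ys \<in> args ar A f; list_all2 (\<lambda>x y. (x, y) \<in> \<theta>) xs ys\<rbrakk>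
           \<Longrightarrow> (oper A f xs, oper A f ys) \<in> \<theta>"
  shows "congruence ar A \<theta>"
  using assms unfolding congruence_def by blast

lemma congruence_equiv: "congruence ar A \<theta> \<Longrightarrow> equiv (univ A) \<theta>"
  by (simp add: congruence_def)

lemma congruence_oper:
  "\<lbrakk>congruence ar A \<theta>; xs \<in> args ar A f; ys \<in> args ar A f; list_all2 (\<lambda>x y. (x, y) \<in> \<theta>) xs ys\<rbrakk>
     \<Longrightarrow> (oper A f xs, oper A f ys) \<in> \<theta>"
  unfolding congruence_def by blast

lemma congruence_full:
  assumes "is_algebra ar A"
  shows "congruence ar A (univ A \<times> univ A)"
  by (rule congruenceI)
     (use assms in \<open>auto simp: equiv_def refl_on_def sym_def trans_def oper_closed\<close>)

text \<open>Serves three times: it gives kernels (pulling back the identity), transport along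
  isomorphisms, and restriction from \<open>star B u\<close> to \<open>B\<close>.\<close>

lemma congruence_pullback:
  assumes A: "is_algebra ar A" and h: "hom ar A B h" and \<theta>: "congruence ar B \<theta>"
  shows "congruence ar A {(x, y). x \<in> univ A \<and> y \<in> univ A \<and> (h x, h y) \<in> \<theta>}"
proof (rule congruenceI)
  have im: "h ` univ A \<subseteq> univ B" using h by (auto simp: hom_def)
  have eq: "equiv (univ B) \<theta>" using \<theta> by (rule congruence_equiv)
  show "equiv (univ A) {(x, y). x \<in> univ A \<and> y \<in> univ A \<and> (h x, h y) \<in> \<theta>}"
  proof (rule equivI)
    show "refl_on (univ A) {(x, y). x \<in> univ A \<and> y \<in> univ A \<and> (h x, h y) \<in> \<theta>}"
      using eq im by (auto simp: equiv_def refl_on_def)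
    show "sym {(x, y). x \<in> univ A \<and> y \<in> univ A \<and> (h x, h y) \<in> \<theta>}"
      using eq by (auto simp: equiv_def sym_def)
    show "trans {(x, y). x \<in> univ A \<and> y \<in> univ A \<and> (h x, h y) \<in> \<theta>}"
      using eq by (auto simp: equiv_def intro!: transI elim: transE)
  qed auto
  fix f xs ys
  assume xs: "xs \<in> args ar A f" and ys: "ys \<in> args ar A f"
    and r: "list_all2 (\<lambda>x y. (x, y) \<in> {(x, y). x \<in> univ A \<and> y \<in> univ A \<and> (h x, h y) \<in> \<theta>}) xs ys"
  have "list_all2 (\<lambda>x y. (x, y) \<in> \<theta>) (map h xs) (map h ys)"
    using r by (auto simp: list_all2_conv_all_nth)
  then have "(oper B f (map h xs), oper B f (map h ys)) \<in> \<theta>"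
    by (rule congruence_oper[OF \<theta> args_map[OF xs im] args_map[OF ys im]])
  then show "(oper A f xs, oper A f ys)
      \<in> {(x, y). x \<in> univ A \<and> y \<in> univ A \<and> (h x, h y) \<in> \<theta>}"
    using oper_closed[OF A xs] oper_closed[OF A ys] hom_oper[OF h xs] hom_oper[OF h ys] by simp
qed

lemma congruence_identity:
  assumes "is_algebra ar A"
  shows "congruence ar A (Id_on (univ A))"
proof (rule congruenceI)
  show "equiv (univ A) (Id_on (univ A))"
    by (auto simp: equiv_def refl_on_def sym_def trans_def)
  fix f xs ys
  assume "xs \<in> args ar A f" "list_all2 (\<lambda>x y. (x, y) \<in> Id_on (univ A)) xs ys"
  moreover from this have "xs = ys"
    by (intro nth_equalityI) (auto simp: list_all2_conv_all_nth)
  ultimately show "(oper A f xs, oper A f ys) \<in> Id_on (univ A)"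
    using oper_closed[OF assms] by auto
qed

lemma congruence_kernel:
  assumes "is_algebra ar A" "is_algebra ar B" "hom ar A B h"
  shows "congruence ar A {(x, y). x \<in> univ A \<and> y \<in> univ A \<and> h x = h y}"
proof -
  have "{(x, y). x \<in> univ A \<and> y \<in> univ A \<and> (h x, h y) \<in> Id_on (univ B)}
      = {(x, y). x \<in> univ A \<and> y \<in> univ A \<and> h x = h y}"
    using assms(3) by (auto simp: hom_def)
  with congruence_pullback[OF assms(1,3) congruence_identity[OF assms(2)]] show ?thesis by simp
qed

section \<open>Quotient algebras\<close>

lemma quotient_algebra_oper:
  assumes A: "is_algebra ar A" and \<theta>: "congruence ar A \<theta>" and xs: "xs \<in> args ar A f"
  shows "oper (quotient_algebra A \<theta>) f (map (\<lambda>x. \<theta> `` {x}) xs) = \<theta> `` {oper A f xs}"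
proof -
  let ?r = "\<lambda>x. SOME y. y \<in> \<theta> `` {x}"
  have eq: "equiv (univ A) \<theta>" using \<theta> by (rule congruence_equiv)
  have r: "(x, ?r x) \<in> \<theta>" if "x \<in> univ A" for x
  proof -
    have "x \<in> \<theta> `` {x}" using equiv_class_self[OF eq that] .
    then have "?r x \<in> \<theta> `` {x}" by (rule someI)
    then show ?thesis by simp
  qed
  have sub: "\<theta> \<subseteq> univ A \<times> univ A" using eq by (rule equiv_type)
  \<comment> \<open>Each argument is related to the representative chosen from its class, so
    compatibility relates the two values.\<close>
  have "map ?r xs \<in> args ar A f" using xs r sub unfolding args_def by fastforce
  moreover have "list_all2 (\<lambda>x y. (x, y) \<in> \<theta>) xs (map ?r xs)"
    using xs r by (auto simp: list_all2_conv_all_nth args_def subset_iff)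
  ultimately have "(oper A f xs, oper A f (map ?r xs)) \<in> \<theta>"
    by (rule congruence_oper[OF \<theta> xs])
  then have "\<theta> `` {oper A f xs} = \<theta> `` {oper A f (map ?r xs)}" using eq by (rule equiv_class_eq[rotated])
  then show ?thesis by (simp add: quotient_algebra_def o_def)
qed

lemma quotient_algebra_is_algebra:
  assumes A: "is_algebra ar A" and \<theta>: "congruence ar A \<theta>"
  shows "is_algebra ar (quotient_algebra A \<theta>)"
proof -
  let ?s = "\<lambda>X. SOME x. x \<in> X"
  have eq: "equiv (univ A) \<theta>" using \<theta> by (rule congruence_equiv)
  have s: "?s X \<in> univ A" if "X \<in> univ A // \<theta>" for X
  proof -
    have "?s X \<in> X" using in_quotient_imp_non_empty[OF eq that] by (simp add: some_in_eq)
    then show ?thesis using in_quotient_imp_subset[OF eq that] by blast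
  qed
  have "oper (quotient_algebra A \<theta>) f Xs \<in> univ (quotient_algebra A \<theta>)"
    if "Xs \<in> args ar (quotient_algebra A \<theta>) f" for f Xs
  proof -
    have "map ?s Xs \<in> args ar A f" using that s by (auto simp: args_def quotient_algebra_def)
    then have "oper A f (map ?s Xs) \<in> univ A" by (rule oper_closed[OF A])
    then show ?thesis by (auto simp: quotient_algebra_def intro: quotientI)
  qed
  moreover have "univ A // \<theta> \<noteq> {}" using A by (auto simp: is_algebra_def quotient_def)
  ultimately show ?thesis by (auto simp: is_algebra_def quotient_algebra_def)
qed

section \<open>Subdirect irreducibility through the monolith\<close>

text \<open>Birkhoff's criterion. Without a monolith, the quotients by all non-identity congruences
  give a subdirect embedding with no injective coordinate; with one, a coordinate separating the
  monolith pair must be injective.\<close>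

lemma subdirectly_irreducible_iff:
  fixes A :: "('f, 'a) algebra"
  assumes A: "is_algebra ar A"
  shows "subdirectly_irreducible ar A \<longleftrightarrow> trivial A \<or> has_monolith ar A"
proof
  assume si: "subdirectly_irreducible ar A"
  show "trivial A \<or> has_monolith ar A"
  proof (rule ccontr)
    assume neg: "\<not> (trivial A \<or> has_monolith ar A)"
    \<comment> \<open>The non-identity congruences are their own indices. Lack of a monolith means
      that every pair of distinct elements is missed by some member of \<open>J\<close>, which makes
      \<open>h\<close> injective.\<close>
    define J where "J = {\<theta>. congruence ar A \<theta> \<and> \<not> \<theta> \<subseteq> Id}"
    define h where "h = (\<lambda>x. \<lambda>\<theta>\<in>J. \<theta> `` {x})"
    have eq: "equiv (univ A) \<theta>" if "\<theta> \<in> J" for \<theta>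
      using that congruence_equiv by (auto simp: J_def)
    have hom: "hom ar A (product_algebra J (quotient_algebra A)) h"
      unfolding hom_def
    proof (intro conjI allI ballI)
      show "h ` univ A \<subseteq> univ (product_algebra J (quotient_algebra A))"
        by (auto simp: h_def product_algebra_def quotient_algebra_def intro: quotientI)
      fix f xs assume xs: "xs \<in> args ar A f"
      show "h (oper A f xs) = oper (product_algebra J (quotient_algebra A)) f (map h xs)"
      proof
        fix \<theta>
        have "oper (quotient_algebra A \<theta>) f (map (\<lambda>x. \<theta> `` {x}) xs) = \<theta> `` {oper A f xs}"
          if "\<theta> \<in> J"
          using quotient_algebra_oper[OF A _ xs] that by (auto simp: J_def)
        then show "h (oper A f xs) \<theta>
            = oper (product_algebra J (quotient_algebra A)) f (map h xs) \<theta>"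
          by (simp add: h_def product_algebra_def o_def)
      qed
    qed
    have inj: "inj_on h (univ A)"
    proof (rule inj_onI, rule ccontr)
      fix c d assume cd: "c \<in> univ A" "d \<in> univ A" "h c = h d" "c \<noteq> d"
      then obtain \<theta> where \<theta>: "\<theta> \<in> J" "(c, d) \<notin> \<theta>"
        using neg unfolding has_monolith_def J_def by blast
      have "\<theta> `` {c} = \<theta> `` {d}" using fun_cong[OF cd(3), of \<theta>] \<theta>(1) by (simp add: h_def)
      then show False using eq_equiv_class[OF _ eq[OF \<theta>(1)] cd(2)] \<theta>(2) by blast
    qed
    have "(\<lambda>x. h x \<theta>) ` univ A = univ (quotient_algebra A \<theta>)" if "\<theta> \<in> J" for \<theta>
      using that by (auto simp: h_def quotient_algebra_def quotient_def)
    then have "subdirect_embedding ar A J (quotient_algebra A) h"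
      using hom inj quotient_algebra_is_algebra[OF A]
      by (auto simp: subdirect_embedding_def J_def)
    then obtain \<theta> where \<theta>: "\<theta> \<in> J" and i: "iso ar A (quotient_algebra A \<theta>) (\<lambda>x. h x \<theta>)"
      using si neg unfolding subdirectly_irreducible_def by blast
    \<comment> \<open>A pair showing that \<open>\<theta>\<close> is not the identity is collapsed
      by the coordinate \<open>\<theta>\<close>, which therefore is no isomorphism.\<close>
    obtain c d where cd: "(c, d) \<in> \<theta>" "c \<noteq> d" using \<theta> by (auto simp: J_def)
    then have "c \<in> univ A" "d \<in> univ A" using equiv_type[OF eq[OF \<theta>]] by auto
    moreover have "h c \<theta> = h d \<theta>"
      using equiv_class_eq[OF eq[OF \<theta>] cd(1)] \<theta> by (simp add: h_def)
    ultimately show False using i cd(2) by (auto simp: iso_def bij_betw_def inj_on_def)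
  qed
next
  assume tm: "trivial A \<or> has_monolith ar A"
  have "\<exists>j\<in>J. iso ar A (C j) (\<lambda>x. h x j)"
    if mono: "has_monolith ar A" and e: "subdirect_embedding ar A J C h"
    for J :: "('a \<times> 'a) set set" and C :: "('a \<times> 'a) set \<Rightarrow> ('f, 'a set) algebra" and h
  proof -
    obtain c d where cd: "c \<in> univ A" "d \<in> univ A" "c \<noteq> d"
      and m: "\<And>\<theta>. congruence ar A \<theta> \<Longrightarrow> \<not> \<theta> \<subseteq> Id \<Longrightarrow> (c, d) \<in> \<theta>"
      using mono unfolding has_monolith_def by blast
    have hom: "hom ar A (product_algebra J C) h" and inj: "inj_on h (univ A)"
      and C: "\<And>j. j \<in> J \<Longrightarrow> is_algebra ar (C j)"
      and onto: "\<And>j. j \<in> J \<Longrightarrow> (\<lambda>x. h x j) ` univ A = univ (C j)"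
      using e by (auto simp: subdirect_embedding_def)
    have "h c \<noteq> h d" using inj cd by (auto simp: inj_on_def)
    moreover have "h c \<in> (\<Pi>\<^sub>E j\<in>J. univ (C j))" "h d \<in> (\<Pi>\<^sub>E j\<in>J. univ (C j))"
      using hom cd by (auto simp: hom_def product_algebra_def)
    ultimately obtain j where j: "j \<in> J" "h c j \<noteq> h d j" by (meson PiE_ext)
    have homj: "hom ar A (C j) (\<lambda>x. h x j)"
      unfolding hom_def
    proof (intro conjI allI ballI)
      show "(\<lambda>x. h x j) ` univ A \<subseteq> univ (C j)" using onto[OF j(1)] by simp
      fix f xs assume "xs \<in> args ar A f"
      from hom_oper[OF hom this]
      show "h (oper A f xs) j = oper (C j) f (map (\<lambda>x. h x j) xs)"
        using j(1) by (simp add: product_algebra_def o_def)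
    qed
    \<comment> \<open>The kernel of this coordinate omits \<open>(c, d)\<close>, so by the choice of
      the pair it is the identity.\<close>
    have "inj_on (\<lambda>x. h x j) (univ A)"
      using m[OF congruence_kernel[OF A C[OF j(1)] homj]] j(2)
      by (auto simp: inj_on_def)
    then show ?thesis using homj onto[OF j(1)] j(1) by (auto simp: iso_def bij_betw_def)
  qed
  then show "subdirectly_irreducible ar A"
    using tm A unfolding subdirectly_irreducible_def by blast
qed

section \<open>Isomorphism invariance\<close>

lemma iso_inverse:
  assumes A: "is_algebra ar A" and h: "iso ar A B h"
  shows "iso ar B A (inv_into (univ A) h)"
proof -
  let ?g = "inv_into (univ A) h"
  have bij: "bij_betw h (univ A) (univ B)" and hom: "hom ar A B h" using h by (auto simp: iso_def)
  have g: "bij_betw ?g (univ B) (univ A)" using bij by (rule bij_betw_inv_into)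
  then have im: "?g ` univ B \<subseteq> univ A" by (simp add: bij_betw_def)
  have "?g (oper B f ys) = oper A f (map ?g ys)" if ys: "ys \<in> args ar B f" for f ys
  proof -
    have xs: "map ?g ys \<in> args ar A f" using ys im by (rule args_map)
    have "map h (map ?g ys) = ys"
      using ys bij_betw_inv_into_right[OF bij] by (auto simp: args_def intro!: map_idI)
    then have "h (oper A f (map ?g ys)) = oper B f ys" using hom_oper[OF hom xs] by simp
    then show ?thesis using bij_betw_inv_into_left[OF bij oper_closed[OF A xs]] by simp
  qed
  then show ?thesis using g im by (auto simp: iso_def hom_def)
qed

text \<open>The argument goes through the monolith, since the definition by embeddings ties indices
  and factors to the element type. The image of the monolith pair works: as \<open>h\<close> is
  onto, a non-identity congruence of \<open>B\<close> pulls back to one of \<open>A\<close>.\<close>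

lemma subdirectly_irreducible_iso:
  assumes A: "is_algebra ar A" and B: "is_algebra ar B" and h: "iso ar A B h"
    and si: "subdirectly_irreducible ar A"
  shows "subdirectly_irreducible ar B"
proof -
  have bij: "bij_betw h (univ A) (univ B)" and hom: "hom ar A B h" using h by (auto simp: iso_def)
  have "trivial B" if "trivial A"
    using that bij unfolding trivial_def bij_betw_def by (metis image_insert image_empty)
  moreover have "has_monolith ar B" if "has_monolith ar A"
  proof -
    obtain c d where cd: "c \<in> univ A" "d \<in> univ A" "c \<noteq> d"
      and m: "\<And>\<theta>. congruence ar A \<theta> \<Longrightarrow> \<not> \<theta> \<subseteq> Id \<Longrightarrow> (c, d) \<in> \<theta>"
      using \<open>has_monolith ar A\<close> unfolding has_monolith_def by blast
    have "(h c, h d) \<in> \<theta>" if \<theta>: "congruence ar B \<theta>" and n: "\<not> \<theta> \<subseteq> Id" for \<theta>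
    proof -
      obtain x y where xy: "(x, y) \<in> \<theta>" "x \<noteq> y" using n by auto
      then have "x \<in> h ` univ A" "y \<in> h ` univ A"
        using equiv_type[OF congruence_equiv[OF \<theta>]] bij by (auto simp: bij_betw_def)
      then obtain x' y' where "x' \<in> univ A" "y' \<in> univ A" "x = h x'" "y = h y'" by blast
      then have "\<not> {(x, y). x \<in> univ A \<and> y \<in> univ A \<and> (h x, h y) \<in> \<theta>} \<subseteq> Id" using xy by auto
      then show ?thesis using m[OF congruence_pullback[OF A hom \<theta>]] by blast
    qed
    moreover have "h c \<noteq> h d" "h c \<in> univ B" "h d \<in> univ B"
      using cd bij by (auto simp: bij_betw_def inj_on_def)
    ultimately show ?thesis unfolding has_monolith_def by blast
  qed
  ultimately show ?thesis
    using si subdirectly_irreducible_iff[OF A] subdirectly_irreducible_iff[OF B] by blast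
qed

section \<open>Terms and identities under homomorphisms\<close>

lemma eval_trm_closed:
  assumes "is_algebra ar A" "range \<rho> \<subseteq> univ A"
  shows "wf_trm ar t \<Longrightarrow> eval_trm A \<rho> t \<in> univ A"
proof (induction t)
  case (Var n)
  then show ?case using assms(2) by auto
next
  case (App f ts)
  then have "map (eval_trm A \<rho>) ts \<in> args ar A f" by (auto simp: args_def)
  then show ?case using oper_closed[OF assms(1)] by simp
qed

lemma eval_trm_hom:
  assumes "is_algebra ar A" "range \<rho> \<subseteq> univ A" "hom ar A B h"
  shows "wf_trm ar t \<Longrightarrow> h (eval_trm A \<rho> t) = eval_trm B (h \<circ> \<rho>) t"
proof (induction t)
  case (Var n)
  then show ?case by simp
next
  case (App f ts)
  then have "map (eval_trm A \<rho>) ts \<in> args ar A f"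
    using eval_trm_closed[OF assms(1,2)] by (auto simp: args_def)
  from hom_oper[OF assms(3) this] App show ?case
    by (auto simp: o_def intro!: arg_cong[of _ _ "oper B f"])
qed

text \<open>An identity of \<open>B\<close> is evaluated at \<open>h \<circ> \<rho>\<close>, and
  injectivity of \<open>h\<close> reflects the resulting equation to \<open>A\<close>.\<close>

lemma variety_iso:
  assumes V: "variety ar V" and B: "B \<in> V" and A: "is_algebra ar A" and h: "iso ar A B h"
  shows "A \<in> V"
proof -
  have hom: "hom ar A B h" and inj: "inj_on h (univ A)"
    using h by (auto simp: iso_def bij_betw_def)
  obtain E where wf: "\<forall>(s, t) \<in> E. wf_trm ar s \<and> wf_trm ar t"
    and VE: "V = {A. is_algebra ar A \<and> (\<forall>e \<in> E. satisfies A e)}"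
    using V unfolding variety_def by blast
  have "satisfies A (s, t)" if st: "(s, t) \<in> E" for s t
    unfolding satisfies_def
  proof (intro allI impI)
    fix \<rho> :: "nat \<Rightarrow> 'b" assume \<rho>: "range \<rho> \<subseteq> univ A"
    have w: "wf_trm ar s" "wf_trm ar t" using wf st by auto
    have "range (h \<circ> \<rho>) \<subseteq> univ B" using \<rho> hom by (auto simp: hom_def)
    then have "eval_trm B (h \<circ> \<rho>) s = eval_trm B (h \<circ> \<rho>) t"
      using B st unfolding VE satisfies_def by fastforce
    then have "h (eval_trm A \<rho> s) = h (eval_trm A \<rho> t)"
      using eval_trm_hom[OF A \<rho> hom] w by simp
    then show "eval_trm A \<rho> (fst (s, t)) = eval_trm A \<rho> (snd (s, t))"
      using inj eval_trm_closed[OF A \<rho>] w by (auto simp: inj_on_def)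
  qed
  then show ?thesis using A unfolding VE by auto
qed

section \<open>P\l{}onka sums\<close>

lemma fibre_index_eq:
  assumes "disjoint_family (\<lambda>i. univ (\<AA> i))" "a \<in> univ (\<AA> i)"
  shows "fibre_index \<AA> a = i"
  unfolding fibre_index_def using assms by (auto simp: disjoint_family_on_def intro!: the_equality)

section \<open>The algebra \<open>star B u\<close> and its congruences\<close>

lemma univ_star: "univ (star B u) = insert u (univ B)"
  by (auto simp: star_def plonka_sum_def trivial_algebra_def split: if_splits)

text \<open>Joins of truth values are disjunctions, and \<open>u\<close> is the only element over
  \<open>True\<close>; so one argument \<open>u\<close> moves the computation to the trivial fibre.
  Constants are read at the least index \<open>False\<close>, hence in \<open>B\<close>.\<close>

lemma oper_star:
  assumes u: "u \<notin> univ B" and xs: "set xs \<subseteq> insert u (univ B)"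
  shows "oper (star B u) f xs = (if u \<in> set xs then u else oper B f xs)"
proof (cases "xs = []")
  case True
  have "(THE i0::bool. \<forall>i. i0 \<le> i) = False" by (rule the_equality) auto
  then show ?thesis unfolding star_def plonka_sum_def by (simp only: True simp_thms if_True if_False list.set algebra.simps empty_iff)
next
  case False
  let ?F = "\<lambda>i::bool. if i then trivial_algebra u else B"
  have fi: "fibre_index ?F a = (a = u)" if "a \<in> insert u (univ B)" for a
    by (rule fibre_index_eq)
       (use u that in \<open>auto simp: disjoint_family_on_def trivial_algebra_def\<close>)
  have im: "fibre_index ?F ` set xs = (\<lambda>a. a = u) ` set xs"
    using xs by (intro image_cong) (auto simp: fi)
  have sup: "Sup_fin ((\<lambda>a. a = u) ` set xs) = (u \<in> set xs)"
    using False by (subst Sup_fin_Sup) auto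
  \<comment> \<open>This is the transition map at join \<open>False\<close>, in its eta-contracted
    form.\<close>
  have "map (If False u) xs = xs"
    by (rule map_idI) simp
  then show ?thesis using False
    by (simp add: star_def plonka_sum_def im sup Let_def trivial_algebra_def)
qed

lemma star_is_algebra:
  assumes "is_algebra ar B" "u \<notin> univ B"
  shows "is_algebra ar (star B u)"
  using assms by (auto simp: is_algebra_def args_def univ_star oper_star)

text \<open>Since \<open>u\<close> is a class by itself, related argument lists have
  \<open>u\<close> at the same positions: either both values are \<open>u\<close>, or both are
  computed in \<open>B\<close>.\<close>

lemma congruence_star_extend:
  assumes u: "u \<notin> univ B" and \<theta>: "congruence ar B \<theta>"
  shows "congruence ar (star B u) (insert (u, u) \<theta>)"
proof (rule congruenceI)
  have eq: "equiv (univ B) \<theta>" using \<theta> by (rule congruence_equiv)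
  then have sub: "\<theta> \<subseteq> univ B \<times> univ B" by (rule equiv_type)
  then show "equiv (univ (star B u)) (insert (u, u) \<theta>)"
    using eq u unfolding univ_star equiv_def refl_on_def sym_def trans_def by blast
  fix f xs ys
  assume xs: "xs \<in> args ar (star B u) f" and ys: "ys \<in> args ar (star B u) f"
    and r: "list_all2 (\<lambda>x y. (x, y) \<in> insert (u, u) \<theta>) xs ys"
  have len: "length xs = length ys" using r by (rule list_all2_lengthD)
  have nth: "(xs ! k, ys ! k) \<in> insert (u, u) \<theta>" if "k < length xs" for k
    using r that by (auto simp: list_all2_conv_all_nth)
  have iff: "xs ! k = u \<longleftrightarrow> ys ! k = u" if "k < length xs" for k
    using nth[OF that] sub u by auto
  then have mem: "u \<in> set xs \<longleftrightarrow> u \<in> set ys" using len by (auto simp: in_set_conv_nth)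
  show "(oper (star B u) f xs, oper (star B u) f ys) \<in> insert (u, u) \<theta>"
  proof (cases "u \<in> set xs")
    case True
    then show ?thesis using mem xs ys u by (auto simp: args_def univ_star oper_star)
  next
    case False
    then have "list_all2 (\<lambda>x y. (x, y) \<in> \<theta>) xs ys"
      using nth len by (force simp: list_all2_conv_all_nth in_set_conv_nth)
    moreover have "xs \<in> args ar B f" "ys \<in> args ar B f"
      using xs ys False mem by (auto simp: args_def univ_star)
    ultimately have "(oper B f xs, oper B f ys) \<in> \<theta>" by (intro congruence_oper[OF \<theta>])
    then show ?thesis using False mem xs ys u by (auto simp: args_def univ_star oper_star)
  qed
qed

text \<open>Glues \<open>a\<close> to \<open>u\<close> and nothing else. Distinct related lists
  differ at a position where both hold \<open>a\<close> or \<open>u\<close>, and any operation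
  applied to such a list returns \<open>a\<close> or \<open>u\<close>.\<close>

lemma congruence_star_absorbing:
  assumes u: "u \<notin> univ B" and B: "is_algebra ar B" and a: "absorbing ar B a"
  shows "congruence ar (star B u) ({(a, u), (u, a)} \<union> Id_on (univ (star B u)))"
    (is "congruence ar _ ?\<theta>")
proof (rule congruenceI)
  have aB: "a \<in> univ B" using a by (simp add: absorbing_def)
  then show "equiv (univ (star B u)) ?\<theta>"
    unfolding univ_star equiv_def refl_on_def sym_def trans_def by auto
  fix f xs ys
  assume xs: "xs \<in> args ar (star B u) f" and ys: "ys \<in> args ar (star B u) f"
    and r: "list_all2 (\<lambda>x y. (x, y) \<in> ?\<theta>) xs ys"
  have key: "oper (star B u) f vs \<in> {u, a}"
    if vs: "vs \<in> args ar (star B u) f" and w: "w \<in> set vs" "w \<in> {u, a}" for vs w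
  proof (cases "u \<in> set vs")
    case True
    then show ?thesis using vs u by (auto simp: args_def univ_star oper_star)
  next
    case False
    then have "vs \<in> args ar B f" "a \<in> set vs" using vs w by (auto simp: args_def univ_star)
    moreover from this have "ar f \<ge> 1" by (cases vs) (auto simp: args_def)
    ultimately have "oper B f vs = a" using a by (auto simp: absorbing_def)
    then show ?thesis using False vs u by (auto simp: args_def univ_star oper_star)
  qed
  show "(oper (star B u) f xs, oper (star B u) f ys) \<in> ?\<theta>"
  proof (cases "xs = ys")
    case True
    then show ?thesis using oper_closed[OF star_is_algebra[OF B u] ys] by auto
  next
    case False
    moreover have "length xs = length ys" using r by (rule list_all2_lengthD)
    ultimately obtain k where k: "k < length xs" "k < length ys" "xs ! k \<noteq> ys ! k"
      by (metis nth_equalityI)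
    then have "(xs ! k, ys ! k) \<in> ?\<theta>" using r by (auto simp: list_all2_conv_all_nth)
    then have "xs ! k \<in> {u, a}" "ys ! k \<in> {u, a}" using k(3) by auto
    then have "oper (star B u) f xs \<in> {u, a}" "oper (star B u) f ys \<in> {u, a}"
      using key[OF xs nth_mem[OF k(1)]] key[OF ys nth_mem[OF k(2)]] by auto
    then show ?thesis using aB by (auto simp: univ_star)
  qed
qed

text \<open>Converse to \<open>congruence_star_absorbing\<close>: replacing \<open>a\<close> by
  \<open>u\<close> among the arguments gives a related list, whose value is
  \<open>u\<close>.\<close>

lemma congruence_star_absorbed:
  assumes u: "u \<notin> univ B" and B: "is_algebra ar B" and nt: "\<not> trivial B"
    and \<theta>: "congruence ar (star B u) \<theta>"
    and id: "\<theta> \<inter> (univ B \<times> univ B) \<subseteq> Id"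
    and a: "(a, u) \<in> \<theta>" "a \<in> univ B"
  shows "absorbing ar B a"
  unfolding absorbing_def
proof (intro conjI allI impI ballI)
  have eq: "equiv (univ (star B u)) \<theta>" using \<theta> by (rule congruence_equiv)
  fix f xs assume xs: "xs \<in> args ar B f" and axs: "a \<in> set xs"
  let ?ys = "map (\<lambda>x. if x = a then u else x) xs"
  have xs': "xs \<in> args ar (star B u) f" and ys: "?ys \<in> args ar (star B u) f"
    using xs by (auto simp: args_def univ_star)
  have "list_all2 (\<lambda>x y. (x, y) \<in> \<theta>) xs ?ys"
    unfolding list_all2_conv_all_nth
  proof (intro conjI allI impI)
    fix k assume k: "k < length xs"
    then have "xs ! k \<in> univ B" using xs by (auto simp: args_def)
    then have "(xs ! k, xs ! k) \<in> \<theta>"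
      using eq by (auto simp: univ_star equiv_def refl_on_def)
    then show "(xs ! k, ?ys ! k) \<in> \<theta>" using a(1) k by auto
  qed simp
  then have "(oper (star B u) f xs, oper (star B u) f ?ys) \<in> \<theta>"
    by (rule congruence_oper[OF \<theta> xs' ys])
  moreover have "u \<in> set ?ys" using axs by force
  then have "oper (star B u) f ?ys = u"
    using ys u by (subst oper_star) (auto simp: args_def univ_star)
  moreover have "oper (star B u) f xs = oper B f xs"
    using xs u by (subst oper_star) (auto simp: args_def)
  ultimately have "(oper B f xs, u) \<in> \<theta>" by simp
  \<comment> \<open>The value in \<open>B\<close> is related to \<open>a\<close> by way of
    \<open>u\<close>; both lie in \<open>B\<close>, where \<open>\<theta>\<close> is the
    identity.\<close>
  then have "(oper B f xs, a) \<in> \<theta>"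
    using a(1) eq by (auto simp: equiv_def elim: symE transE)
  then show "oper B f xs = a" using id a(2) oper_closed[OF B xs] by auto
qed (use nt a in auto)

text \<open>\<open>B\<close> is a subalgebra of \<open>star B u\<close>, constants included, so the
  congruence is pulled back along the inclusion.\<close>

lemma congruence_star_restrict:
  assumes u: "u \<notin> univ B" and B: "is_algebra ar B" and \<theta>: "congruence ar (star B u) \<theta>"
  shows "congruence ar B (\<theta> \<inter> (univ B \<times> univ B))"
proof -
  have "hom ar B (star B u) (\<lambda>x. x)"
    unfolding hom_def
  proof (intro conjI allI ballI)
    fix f xs assume "xs \<in> args ar B f"
    then have xs: "set xs \<subseteq> univ B" by (simp add: args_def)
    then have "set xs \<subseteq> insert u (univ B)" by blast
    from oper_star[OF u this, of f] xs u
    show "oper B f xs = oper (star B u) f (map (\<lambda>x. x) xs)" by auto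
  qed (simp add: univ_star subset_insertI)
  moreover have "{(x, y). x \<in> univ B \<and> y \<in> univ B \<and> (x, y) \<in> \<theta>} = \<theta> \<inter> (univ B \<times> univ B)"
    by auto
  ultimately show ?thesis using congruence_pullback[OF B _ \<theta>] by fastforce
qed

lemma subdirectly_irreducible_star_iff:
  assumes u: "u \<notin> univ B" and B: "is_algebra ar B"
  shows "subdirectly_irreducible ar (star B u) \<longleftrightarrow>
     subdirectly_irreducible ar B \<and> (\<nexists>a. absorbing ar B a)"
proof -
  have S: "is_algebra ar (star B u)" using B u by (rule star_is_algebra)
  have ntS: "\<not> trivial (star B u)"
    using u B by (auto simp: trivial_def univ_star is_algebra_def)
  show ?thesis
  proof (cases "trivial B")
    case True
    then obtain b where b: "univ B = {b}" by (auto simp: trivial_def)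
    \<comment> \<open>On the two-element universe the only non-identity congruence is the full one.
      A trivial \<open>B\<close> is subdirectly irreducible by convention and has no absorbing
      elements, so both sides of the equivalence hold.\<close>
    have "(u, b) \<in> \<theta>" if \<theta>: "congruence ar (star B u) \<theta>" "\<not> \<theta> \<subseteq> Id" for \<theta>
    proof -
      have eq: "equiv {u, b} \<theta>" using congruence_equiv[OF \<theta>(1)] by (simp add: univ_star b)
      obtain x y where "(x, y) \<in> \<theta>" "x \<noteq> y" using \<theta>(2) by auto
      then have "(u, b) \<in> \<theta> \<or> (b, u) \<in> \<theta>" using equiv_type[OF eq] by auto
      then show ?thesis using eq by (auto simp: equiv_def sym_def)
    qed
    then have "has_monolith ar (star B u)"
      using u b unfolding has_monolith_def univ_star by fastforce
    then show ?thesis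
      using True subdirectly_irreducible_iff[OF S] subdirectly_irreducible_iff[OF B]
      by (auto simp: absorbing_def)
  next
    case nt: False
    have "has_monolith ar (star B u) \<longleftrightarrow> has_monolith ar B \<and> (\<nexists>a. absorbing ar B a)"
    proof
      assume "has_monolith ar (star B u)"
      then obtain c d where cd: "c \<noteq> d"
        and m: "\<And>\<theta>. congruence ar (star B u) \<theta> \<Longrightarrow> \<not> \<theta> \<subseteq> Id \<Longrightarrow> (c, d) \<in> \<theta>"
        unfolding has_monolith_def by blast
      have ext: "(c, d) \<in> \<theta>" if "congruence ar B \<theta>" "\<not> \<theta> \<subseteq> Id" for \<theta>
        using m[OF congruence_star_extend[OF u that(1)]] that(2) cd by auto
      \<comment> \<open>Extending the full congruence of \<open>B\<close> by the class of
        \<open>u\<close> alone forces the monolith pair into \<open>B\<close>.\<close>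
      have "\<not> univ B \<times> univ B \<subseteq> Id"
        using nt B by (fastforce simp: trivial_def is_algebra_def)
      then have cdB: "c \<in> univ B" "d \<in> univ B"
        using ext[OF congruence_full[OF B]] by auto
      have "\<not> absorbing ar B a" for a
      proof
        assume a: "absorbing ar B a"
        then have "a \<in> univ B" by (simp add: absorbing_def)
        \<comment> \<open>Off the diagonal this congruence only relates \<open>a\<close> and
          \<open>u\<close>, so it cannot contain two distinct elements of \<open>B\<close>.\<close>
        then have "(c, d) \<in> {(a, u), (u, a)} \<union> Id_on (univ (star B u))"
          using m[OF congruence_star_absorbing[OF u B a]] u by auto
        then show False using cd cdB u by auto
      qed
      then show "has_monolith ar B \<and> (\<nexists>a. absorbing ar B a)"
        using cd cdB ext unfolding has_monolith_def by blast
    next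
      assume R: "has_monolith ar B \<and> (\<nexists>a. absorbing ar B a)"
      then obtain c d where cd: "c \<in> univ B" "d \<in> univ B" "c \<noteq> d"
        and m: "\<And>\<theta>. congruence ar B \<theta> \<Longrightarrow> \<not> \<theta> \<subseteq> Id \<Longrightarrow> (c, d) \<in> \<theta>"
        unfolding has_monolith_def by blast
      have "(c, d) \<in> \<theta>" if \<theta>: "congruence ar (star B u) \<theta>" and n: "\<not> \<theta> \<subseteq> Id" for \<theta>
      proof (rule ccontr)
        assume "(c, d) \<notin> \<theta>"
        then have id: "\<theta> \<inter> (univ B \<times> univ B) \<subseteq> Id"
          using m[OF congruence_star_restrict[OF u B \<theta>]] by blast
        have eq: "equiv (insert u (univ B)) \<theta>"
          using congruence_equiv[OF \<theta>] by (simp add: univ_star)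
        obtain x y where xy: "(x, y) \<in> \<theta>" "x \<noteq> y" using n by auto
        then have "(y, x) \<in> \<theta>" using eq by (auto simp: equiv_def sym_def)
        \<comment> \<open>As \<open>\<theta>\<close> is the identity on \<open>B\<close>, one of
          \<open>x\<close> and \<open>y\<close> is \<open>u\<close>; symmetry puts it
          second.\<close>
        with xy obtain a where "(a, u) \<in> \<theta>" "a \<in> univ B"
          using id equiv_type[OF eq] by blast
        then show False using congruence_star_absorbed[OF u B nt \<theta> id] R by blast
      qed
      then show "has_monolith ar (star B u)"
        using cd unfolding has_monolith_def univ_star by blast
    qed
    then show ?thesis
      using nt ntS subdirectly_irreducible_iff[OF S] subdirectly_irreducible_iff[OF B] by blast
  qed
qed

section \<open>Homomorphisms from a Plonka sum to its fibres\<close>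

text \<open>The point at infinity is a parameter \<open>u\<close>, so that one map covers both
  targets, \<open>\<AA> i\<close> and \<open>star (\<AA> i) u\<close>.\<close>

definition fibre_map ::
  "('i::semilattice_sup \<Rightarrow> ('f, 'a) algebra) \<Rightarrow> ('i \<Rightarrow> 'i \<Rightarrow> 'a \<Rightarrow> 'a) \<Rightarrow> 'i \<Rightarrow> 'a \<Rightarrow> 'a \<Rightarrow> 'a"
where
  "fibre_map \<AA> p i u a = (if fibre_index \<AA> a \<le> i then p (fibre_index \<AA> a) i a else u)"

context
  fixes ar :: "'f \<Rightarrow> nat"
    and \<AA> :: "'i::semilattice_sup \<Rightarrow> ('f, 'a) algebra"
    and p :: "'i \<Rightarrow> 'i \<Rightarrow> 'a \<Rightarrow> 'a"
  assumes sys: "semilattice_direct_system ar \<AA> p"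
begin

lemmas sys_conj = sys[unfolded semilattice_direct_system_def]

lemma sys_least: "ar c = 0 \<Longrightarrow> \<exists>i0::'i. \<forall>i. i0 \<le> i"
  using sys_conj[THEN conjunct1] by blast

lemma sys_algebra: "is_algebra ar (\<AA> i)"
  using sys_conj[THEN conjunct2, THEN conjunct1] by blast

lemma sys_disjoint: "disjoint_family (\<lambda>i. univ (\<AA> i))"
  by (rule sys_conj[THEN conjunct2, THEN conjunct2, THEN conjunct1])

lemma sys_hom: "i \<le> j \<Longrightarrow> hom ar (\<AA> i) (\<AA> j) (p i j)"
  using sys_conj[THEN conjunct2, THEN conjunct2, THEN conjunct2, THEN conjunct1] by blast

lemma sys_closed: "i \<le> j \<Longrightarrow> a \<in> univ (\<AA> i) \<Longrightarrow> p i j a \<in> univ (\<AA> j)"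
  using sys_hom[of i j] by (auto simp: hom_def)

lemma sys_refl: "a \<in> univ (\<AA> i) \<Longrightarrow> p i i a = a"
  using sys_conj[THEN conjunct2, THEN conjunct2, THEN conjunct2, THEN conjunct2, THEN conjunct1]
  by blast

lemma sys_comp:
  assumes "i \<le> j" "j \<le> k" "a \<in> univ (\<AA> i)"
  shows "p j k (p i j a) = p i k a"
  using sys_conj[THEN conjunct2, THEN conjunct2, THEN conjunct2, THEN conjunct2, THEN conjunct2,
      rule_format, OF assms] by (rule sym)

lemma fibre_index: "a \<in> univ (\<AA> i) \<Longrightarrow> fibre_index \<AA> a = i"
  by (rule fibre_index_eq[OF sys_disjoint])

lemma univ_plonka_sum: "univ (plonka_sum \<AA> p) = (\<Union>i. univ (\<AA> i))"
  by (simp add: plonka_sum_def)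

lemma mem_fibre: "a \<in> univ (plonka_sum \<AA> p) \<Longrightarrow> a \<in> univ (\<AA> (fibre_index \<AA> a))"
  using fibre_index by (auto simp: univ_plonka_sum)

text \<open>The condition on \<open>j\<close> says that \<open>j\<close> is the join of the indices of \<open>xs\<close>, or the least
  index if \<open>xs\<close> is empty.\<close>

lemma oper_plonka_sum:
  assumes xs: "xs \<in> args ar (plonka_sum \<AA> p) f"
  obtains j where "\<And>i. j \<le> i \<longleftrightarrow> (\<forall>x\<in>set xs. fibre_index \<AA> x \<le> i)"
    and "map (\<lambda>a. p (fibre_index \<AA> a) j a) xs \<in> args ar (\<AA> j) f"
    and "oper (plonka_sum \<AA> p) f xs = oper (\<AA> j) f (map (\<lambda>a. p (fibre_index \<AA> a) j a) xs)"
proof -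
  have "\<exists>j. (\<forall>i. j \<le> i \<longleftrightarrow> (\<forall>x\<in>set xs. fibre_index \<AA> x \<le> i)) \<and>
    oper (plonka_sum \<AA> p) f xs = oper (\<AA> j) f (map (\<lambda>a. p (fibre_index \<AA> a) j a) xs)"
  proof (cases "xs = []")
    case True
    then have "ar f = 0" using xs by (simp add: args_def)
    then obtain i0 :: 'i where i0: "\<forall>i. i0 \<le> i" using sys_least by blast
    have "(THE i0::'i. \<forall>i. i0 \<le> i) = i0"
      by (rule the_equality) (use i0 in \<open>auto intro: order.antisym\<close>)
    then show ?thesis using True i0 by (auto simp: plonka_sum_def)
  next
    case False
    then show ?thesis
      by (intro exI[of _ "Sup_fin (fibre_index \<AA> ` set xs)"])
         (auto simp: plonka_sum_def Let_def Sup_fin.bounded_iff)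
  qed
  then obtain j where j: "\<And>i. j \<le> i \<longleftrightarrow> (\<forall>x\<in>set xs. fibre_index \<AA> x \<le> i)"
    and o: "oper (plonka_sum \<AA> p) f xs = oper (\<AA> j) f (map (\<lambda>a. p (fibre_index \<AA> a) j a) xs)"
    by blast
  have "fibre_index \<AA> x \<le> j" if "x \<in> set xs" for x using j[of j] that by simp
  then have "map (\<lambda>a. p (fibre_index \<AA> a) j a) xs \<in> args ar (\<AA> j) f"
    using xs sys_closed mem_fibre by (auto simp: args_def)
  from j this o show ?thesis by (rule that)
qed

lemma plonka_sum_is_algebra: "is_algebra ar (plonka_sum \<AA> p)"
proof -
  have "oper (plonka_sum \<AA> p) f xs \<in> univ (plonka_sum \<AA> p)"
    if "xs \<in> args ar (plonka_sum \<AA> p) f" for f xs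
    using that
  proof (rule oper_plonka_sum)
    fix j
    assume "map (\<lambda>a. p (fibre_index \<AA> a) j a) xs \<in> args ar (\<AA> j) f"
      and "oper (plonka_sum \<AA> p) f xs = oper (\<AA> j) f (map (\<lambda>a. p (fibre_index \<AA> a) j a) xs)"
    then show ?thesis using oper_closed[OF sys_algebra] by (auto simp: univ_plonka_sum)
  qed
  moreover have "univ (plonka_sum \<AA> p) \<noteq> {}"
    using sys_algebra by (auto simp: univ_plonka_sum is_algebra_def)
  ultimately show ?thesis by (simp add: is_algebra_def)
qed

lemma fibre_map_same: "a \<in> univ (\<AA> i) \<Longrightarrow> fibre_map \<AA> p i u a = a"
  by (simp add: fibre_map_def fibre_index sys_refl)

lemma fibre_map_closed:
  "a \<in> univ (plonka_sum \<AA> p) \<Longrightarrow> fibre_index \<AA> a \<le> i \<Longrightarrow> fibre_map \<AA> p i u a \<in> univ (\<AA> i)"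
  by (simp add: fibre_map_def sys_closed mem_fibre)

text \<open>The value lies in the fibre over the join \<open>j\<close> of the argument indices, and
  \<open>j \<le> i\<close> holds iff all these indices are below \<open>i\<close>; then
  \<open>p j i\<close> is a homomorphism. For constants the condition is vacuous and
  \<open>j\<close> is the least index.\<close>

lemma fibre_map_oper:
  assumes xs: "xs \<in> args ar (plonka_sum \<AA> p) f"
  shows "fibre_map \<AA> p i u (oper (plonka_sum \<AA> p) f xs) =
    (if \<forall>x\<in>set xs. fibre_index \<AA> x \<le> i then oper (\<AA> i) f (map (fibre_map \<AA> p i u) xs) else u)"
  using xs
proof (rule oper_plonka_sum)
  fix j
  let ?ys = "map (\<lambda>a. p (fibre_index \<AA> a) j a) xs"
  assume j: "\<And>i. j \<le> i \<longleftrightarrow> (\<forall>x\<in>set xs. fibre_index \<AA> x \<le> i)"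
    and ys: "?ys \<in> args ar (\<AA> j) f"
    and o: "oper (plonka_sum \<AA> p) f xs = oper (\<AA> j) f ?ys"
  have jf: "fibre_index \<AA> (oper (\<AA> j) f ?ys) = j"
    using oper_closed[OF sys_algebra ys] by (rule fibre_index)
  have "p j i (oper (\<AA> j) f ?ys) = oper (\<AA> i) f (map (fibre_map \<AA> p i u) xs)" if ji: "j \<le> i"
  proof -
    \<comment> \<open>Passing through the join and then to \<open>i\<close> is the same as passing
      to \<open>i\<close> directly.\<close>
    have "map (p j i) ?ys = map (fibre_map \<AA> p i u) xs"
      using ji j[of j] j[of i] xs mem_fibre
      by (auto simp: fibre_map_def args_def intro!: sys_comp)
    then show ?thesis using hom_oper[OF sys_hom[OF ji] ys] by (simp only:)
  qed
  then show ?thesis by (simp add: o fibre_map_def[of _ _ _ _ "oper (\<AA> j) f ?ys"] jf j)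
qed

text \<open>If the index of \<open>c\<close> is not below that of \<open>d\<close>, take
  \<open>i\<close> to be the index of \<open>d\<close>: then \<open>d\<close> is fixed and
  \<open>c\<close> goes to \<open>u\<close>. Otherwise take the index of \<open>c\<close>: either
  the same happens with the roles exchanged, or the indices agree and both points are fixed. The
  choice of \<open>i\<close> precedes that of \<open>u\<close>.\<close>

lemma fibre_map_separates:
  assumes "c \<in> univ (plonka_sum \<AA> p)" "d \<in> univ (plonka_sum \<AA> p)" "c \<noteq> d"
  obtains i where "\<And>u. u \<notin> univ (\<AA> i) \<Longrightarrow> fibre_map \<AA> p i u c \<noteq> fibre_map \<AA> p i u d"
proof (cases "fibre_index \<AA> c \<le> fibre_index \<AA> d")
  case False
  have "fibre_map \<AA> p (fibre_index \<AA> d) u c \<noteq> fibre_map \<AA> p (fibre_index \<AA> d) u d"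
    if "u \<notin> univ (\<AA> (fibre_index \<AA> d))" for u
    using that False fibre_map_same[OF mem_fibre[OF assms(2)]] mem_fibre[OF assms(2)]
    by (auto simp: fibre_map_def[of _ _ _ _ c])
  then show ?thesis by (rule that)
next
  case True
  have "fibre_map \<AA> p (fibre_index \<AA> c) u c \<noteq> fibre_map \<AA> p (fibre_index \<AA> c) u d"
    if u: "u \<notin> univ (\<AA> (fibre_index \<AA> c))" for u
  proof (cases "fibre_index \<AA> d \<le> fibre_index \<AA> c")
    case False
    then show ?thesis
      using u fibre_map_same[OF mem_fibre[OF assms(1)]] mem_fibre[OF assms(1)]
      by (auto simp: fibre_map_def[of _ _ _ _ d])
  next
    case le: True
    then have "fibre_index \<AA> d = fibre_index \<AA> c" using True by simp
    then show ?thesis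
      using fibre_map_same[OF mem_fibre[OF assms(1)]] fibre_map_same[OF mem_fibre[OF assms(2)]]
        assms(3) by simp
  qed
  then show ?thesis by (rule that)
qed

text \<open>The fibre over \<open>i\<close> is fixed pointwise. A fibre whose index is not below
  \<open>i\<close> is nonempty and is sent to \<open>u\<close>; such a fibre exists iff
  \<open>i\<close> is not greatest.\<close>

lemma fibre_map_image:
  "fibre_map \<AA> p i u ` univ (plonka_sum \<AA> p) =
     (if \<forall>k. k \<le> i then univ (\<AA> i) else insert u (univ (\<AA> i)))"
proof -
  have "a \<in> fibre_map \<AA> p i u ` univ (plonka_sum \<AA> p)" if "a \<in> univ (\<AA> i)" for a
    using that by (intro image_eqI[of _ _ a]) (auto simp: fibre_map_same univ_plonka_sum)
  moreover have "u \<in> fibre_map \<AA> p i u ` univ (plonka_sum \<AA> p)" if k: "\<not> k \<le> i" for k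
  proof -
    obtain a where a: "a \<in> univ (\<AA> k)" using sys_algebra[of k] by (auto simp: is_algebra_def)
    then have "fibre_map \<AA> p i u a = u" using k by (simp add: fibre_map_def fibre_index)
    then show ?thesis using a by (intro image_eqI[of _ _ a]) (auto simp: univ_plonka_sum)
  qed
  moreover have "fibre_map \<AA> p i u a \<in> univ (\<AA> i)"
    if "a \<in> univ (plonka_sum \<AA> p)" "\<forall>k. k \<le> i" for a
    using that by (simp add: fibre_map_closed)
  moreover have "fibre_map \<AA> p i u a \<in> insert u (univ (\<AA> i))"
    if "a \<in> univ (plonka_sum \<AA> p)" for a
    using that fibre_map_closed[of a i u] by (auto simp: fibre_map_def)
  ultimately show ?thesis by auto
qed

lemma fibre_map_hom_top:
  assumes "\<forall>k. k \<le> i"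
  shows "hom ar (plonka_sum \<AA> p) (\<AA> i) (fibre_map \<AA> p i u)"
  unfolding hom_def using assms fibre_map_image by (simp add: fibre_map_oper)

text \<open>As \<open>u\<close> lies outside \<open>\<AA> i\<close>, an argument is mapped to
  \<open>u\<close> exactly when its index is not below \<open>i\<close>; so the case distinctions of
  \<open>fibre_map_oper\<close> and \<open>oper_star\<close> agree.\<close>

lemma fibre_map_hom_star:
  assumes u: "u \<notin> univ (\<AA> i)"
  shows "hom ar (plonka_sum \<AA> p) (star (\<AA> i) u) (fibre_map \<AA> p i u)"
  unfolding hom_def
proof (intro conjI allI ballI)
  show im: "fibre_map \<AA> p i u ` univ (plonka_sum \<AA> p) \<subseteq> univ (star (\<AA> i) u)"
    unfolding fibre_map_image univ_star by auto
  fix f xs assume xs: "xs \<in> args ar (plonka_sum \<AA> p) f"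
  have iff: "fibre_map \<AA> p i u x = u \<longleftrightarrow> \<not> fibre_index \<AA> x \<le> i" if "x \<in> set xs" for x
    using fibre_map_closed[of x i u] u xs that by (auto simp: fibre_map_def args_def)
  have "set (map (fibre_map \<AA> p i u) xs) \<subseteq> insert u (univ (\<AA> i))"
    using args_map[OF xs im] unfolding args_def univ_star by blast
  note oper_star[OF u this]
  moreover have "u \<in> set (map (fibre_map \<AA> p i u) xs) \<longleftrightarrow> \<not> (\<forall>x\<in>set xs. fibre_index \<AA> x \<le> i)"
    using iff by force
  ultimately show "fibre_map \<AA> p i u (oper (plonka_sum \<AA> p) f xs)
      = oper (star (\<AA> i) u) f (map (fibre_map \<AA> p i u) xs)"
    unfolding fibre_map_oper[OF xs] by simp
qed

text \<open>Choose \<open>i\<close> so that the map separates the monolith pair; its kernel omits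
  that pair and is therefore the identity.\<close>

lemma subdirectly_irreducible_fibre_map_inj:
  assumes si: "subdirectly_irreducible ar (plonka_sum \<AA> p)"
  obtains i where "\<And>u. u \<notin> univ (\<AA> i) \<Longrightarrow> inj_on (fibre_map \<AA> p i u) (univ (plonka_sum \<AA> p))"
proof (cases "trivial (plonka_sum \<AA> p)")
  case True
  then show ?thesis using that by (auto simp: trivial_def)
next
  case False
  then have "has_monolith ar (plonka_sum \<AA> p)"
    using si subdirectly_irreducible_iff[OF plonka_sum_is_algebra] by blast
  then obtain c d where cd: "c \<in> univ (plonka_sum \<AA> p)" "d \<in> univ (plonka_sum \<AA> p)" "c \<noteq> d"
    and m: "\<And>\<theta>. congruence ar (plonka_sum \<AA> p) \<theta> \<Longrightarrow> \<not> \<theta> \<subseteq> Id \<Longrightarrow> (c, d) \<in> \<theta>"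
    unfolding has_monolith_def by blast
  obtain i where i: "\<And>u. u \<notin> univ (\<AA> i) \<Longrightarrow> fibre_map \<AA> p i u c \<noteq> fibre_map \<AA> p i u d"
    using fibre_map_separates[OF cd] by blast
  have "inj_on (fibre_map \<AA> p i u) (univ (plonka_sum \<AA> p))" if u: "u \<notin> univ (\<AA> i)" for u
    using m[OF congruence_kernel[OF plonka_sum_is_algebra
        star_is_algebra[OF sys_algebra u] fibre_map_hom_star[OF u]]] i[OF u]
    by (auto simp: inj_on_def)
  then show ?thesis by (rule that)
qed

end

section \<open>Subdirectly irreducible Plonka sums\<close>

theorem theorem6:
  fixes ar :: "'f \<Rightarrow> nat"
    and V :: "('f, 'a) algebra set"
    and \<AA> :: "'i::semilattice_sup \<Rightarrow> ('f, 'a) algebra"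
    and p :: "'i \<Rightarrow> 'i \<Rightarrow> 'a \<Rightarrow> 'a"
    and A :: "('f, 'a) algebra"
  assumes "plural ar"
    and "variety ar V"
    and "semilattice_direct_system ar \<AA> p"
    and "\<And>i. \<AA> i \<in> V"
    and "A = plonka_sum \<AA> p"
  shows "subdirectly_irreducible ar A \<longleftrightarrow>
    (subdirectly_irreducible ar A \<and> A \<in> V) \<or>
    (\<exists>(B :: ('f, 'a) algebra) u.
       B \<in> V \<and> subdirectly_irreducible ar B \<and> (\<nexists>a. absorbing ar B a) \<and>
       u \<notin> univ B \<and> isomorphic ar A (star B u))"
    (is "_ \<longleftrightarrow> _ \<or> ?star")
proof -
  note sys = assms(3)
  have A: "is_algebra ar A" using plonka_sum_is_algebra[OF sys] assms(5) by simp
  \<comment> \<open>Subdirect irreducibility is part of the first alternative, so the forward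
    direction reduces to this disjunction.\<close>
  have "A \<in> V \<or> ?star" if si: "subdirectly_irreducible ar A"
  proof -
    obtain i where
      inj: "\<And>u. u \<notin> univ (\<AA> i) \<Longrightarrow> inj_on (fibre_map \<AA> p i u) (univ A)"
      using subdirectly_irreducible_fibre_map_inj[OF sys] si assms(5) by metis
    show ?thesis
    proof (cases "\<forall>k. k \<le> i")
      case top: True
      \<comment> \<open>Here the value \<open>u\<close> is never attained, and \<open>'a\<close> may have no element outside
        \<open>univ (\<AA> i)\<close> at all; then \<open>i\<close> is the only index.\<close>
      have "inj_on (fibre_map \<AA> p i u) (univ A)" for u
      proof (cases "univ (\<AA> i) = UNIV")
        case True
        then show ?thesis by (auto intro!: inj_onI simp: fibre_map_same[OF sys])
      next
        case False
        then obtain v where "v \<notin> univ (\<AA> i)" by blast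
        moreover have "fibre_map \<AA> p i u = fibre_map \<AA> p i v"
          using top by (auto simp: fibre_map_def)
        ultimately show ?thesis using inj by simp
      qed
      \<comment> \<open>With \<open>i\<close> greatest, \<open>undefined\<close> only fills a branch
        that is never reached. \<open>A\<close> is thus isomorphic to a fibre, a member of
        \<open>V\<close>.\<close>
      then have "iso ar A (\<AA> i) (fibre_map \<AA> p i undefined)"
        using fibre_map_hom_top[OF sys top] fibre_map_image[OF sys, of i] top
        by (simp add: iso_def bij_betw_def assms(5))
      then show ?thesis using variety_iso[OF assms(2) assms(4) A] by blast
    next
      case False
      then obtain k where k: "\<not> k \<le> i" by blast
      \<comment> \<open>A fibre not below \<open>i\<close> supplies the point at infinity: fibres
        are nonempty and disjoint.\<close>
      obtain u where "u \<in> univ (\<AA> k)" using sys_algebra[OF sys, of k] by (auto simp: is_algebra_def)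
      then have u: "u \<notin> univ (\<AA> i)" using fibre_index[OF sys] k by blast
      have iso: "iso ar A (star (\<AA> i) u) (fibre_map \<AA> p i u)"
        using fibre_map_hom_star[OF sys u] fibre_map_image[OF sys, of i u] inj[OF u] False
        by (simp add: iso_def bij_betw_def assms(5) univ_star)
      then have "subdirectly_irreducible ar (star (\<AA> i) u)"
        using subdirectly_irreducible_iso[OF A star_is_algebra[OF sys_algebra[OF sys] u]] si
        by blast
      then show ?thesis
        using subdirectly_irreducible_star_iff[OF u sys_algebra[OF sys]] u iso assms(4)
        unfolding isomorphic_def by blast
    qed
  qed
  moreover have "subdirectly_irreducible ar A" if ?star
  proof -
    obtain B :: "('f, 'a) algebra" and u h where B: "subdirectly_irreducible ar B" "\<nexists>a. absorbing ar B a" "u \<notin> univ B"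
      and h: "iso ar A (star B u) h"
      using \<open>?star\<close> unfolding isomorphic_def by blast
    have "is_algebra ar B" using B(1) by (simp add: subdirectly_irreducible_def)
    note S = subdirectly_irreducible_star_iff[OF B(3) this] star_is_algebra[OF this B(3)]
    have "subdirectly_irreducible ar (star B u)" using S(1) B by simp
    \<comment> \<open>The given isomorphism starts at \<open>A\<close>, so its inverse carries the
      property back.\<close>
    then show ?thesis by (rule subdirectly_irreducible_iso[OF S(2) A iso_inverse[OF A h]])
  qed
  ultimately show ?thesis by blast
qed

end
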